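(* Let $\alpha\in(0,1)$, and let $A,B$ be the fixed smooth coefficients defined in the context. There are constants $c,C_\alpha>0$ (independent of $N$) such that for all sufficiently large $N$ there are a function $c_N=c_N(x,p)$ and a smooth stationary (i.e. $t$-independent) solution $\widetilde f_N$ of $$\partial_t\widetilde f_N+\frac{p}{\langle p\rangle}\cdot\nabla_x\widetilde f_N=\operatorname{tr}\bigl(A(p)D_p^2\widetilde f_N\bigr)+B(p)\cdot\nabla_p\widetilde f_N+c_N(x,p)\,\widetilde f_N$$ on $\mathcal Q_1$ (so with zero external source) such that $$\frac12\le\widetilde f_N\le\frac32,\qquad \|c_N\|_{L^\infty(\mathcal Q_1)}\le 2,\qquad [c_N]_{C_p^\alpha(\mathcal Q_1)}\le C_\alpha N^{(\alpha-2)/3}\longrightarrow 0\quad (N\to\infty),$$ whereas $$[D_p^2\widetilde f_N]_{C_p^\alpha(\mathcal Q_{1/2})}\ge c\,N^{\alpha/3}.$$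
   Context: Variables: $t\in\mathbb R$, $x\in\mathbb R^3$, $p\in\mathbb R^3$; $\langle p\rangle=(1+|p|^2)^{1/2}$. Coefficients: $$A(p)=\langle p\rangle^2(\mathrm{Id}+p\otimes p)^2,\qquad B(p)=\bigl(3\langle p\rangle^4+2\langle p\rangle^2\bigr)p.$$ Cylinders: for $r>0$, $\mathcal Q_r=(-r^2,0]\times B_{r^3}^x\times B_r^p$, where $B^x_\rho,B^p_\rho$ are the balls of radius $\rho$ centered at $0$ in $x$ and $p$. Momentum H\"older seminorm: for $h=h(t,x,p)$ on a product cylinder $Q$, $$[h]_{C_p^\alpha(Q)}=\sup_{\substack{(t,x,p),(t,x,p')\in Q\\0<|p-p'|<1/2}}\frac{|h(t,x,p)-h(t,x,p')|}{|p-p'|^\alpha}.$$ Matrix-valued functions (such as the $p$-Hessian $D_p^2\widetilde f_N$) are measured in the Frobenius norm; functions of $(x,p)$ are regarded as $t$-independent functions of $(t,x,p)$. *)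

theory Defs
  imports "HOL-Analysis.Analysis" "HOL-Probability.Essential_Supremum"
begin

type_synonym phase = "(real ^ 3) \<times> (real ^ 3)"   (* points (x, p) *)
type_synonym tphase = "real \<times> phase"             (* points (t, x, p) *)

definition bracket :: "real ^ 3 \<Rightarrow> real" where
  "bracket p = sqrt (1 + (norm p)\<^sup>2)"

definition tensor :: "real ^ 3 \<Rightarrow> real ^ 3 \<Rightarrow> real ^ 3 ^ 3" where
  "tensor u v = (\<chi> i j. u $ i * v $ j)"

definition A :: "real ^ 3 \<Rightarrow> real ^ 3 ^ 3" where
  "A p = (bracket p)\<^sup>2 *\<^sub>R ((mat 1 + tensor p p) ** (mat 1 + tensor p p))"

definition B :: "real ^ 3 \<Rightarrow> real ^ 3" where
  "B p = (3 * bracket p ^ 4 + 2 * (bracket p)\<^sup>2) *\<^sub>R p"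

definition cylinder :: "real \<Rightarrow> tphase set" where
  "cylinder r = {- (r\<^sup>2)<..0} \<times> ball 0 (r ^ 3) \<times> ball 0 r"

definition grad :: "(real ^ 3 \<Rightarrow> real) \<Rightarrow> real ^ 3 \<Rightarrow> real ^ 3" where
  "grad h p = (\<chi> i. frechet_derivative h (at p) (axis i 1))"

definition hess :: "(real ^ 3 \<Rightarrow> real) \<Rightarrow> real ^ 3 \<Rightarrow> real ^ 3 ^ 3" where
  "hess h p = (\<chi> i j. grad (\<lambda>q. grad h q $ j) p $ i)"

definition grad_x :: "(tphase \<Rightarrow> real) \<Rightarrow> tphase \<Rightarrow> real ^ 3" where
  "grad_x f = (\<lambda>(t, x, p). grad (\<lambda>y. f (t, y, p)) x)"

definition grad_p :: "(tphase \<Rightarrow> real) \<Rightarrow> tphase \<Rightarrow> real ^ 3" where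
  "grad_p f = (\<lambda>(t, x, p). grad (\<lambda>q. f (t, x, q)) p)"

definition hess_p :: "(tphase \<Rightarrow> real) \<Rightarrow> tphase \<Rightarrow> real ^ 3 ^ 3" where
  "hess_p f = (\<lambda>(t, x, p). hess (\<lambda>q. f (t, x, q)) p)"

text \<open>
  The cylinder contains its final time \<open>t = 0\<close>, hence the time derivative relative to
  the time interval of the cylinder (one-sided at \<open>t = 0\<close>).  The derivative operators are
  total functions, so this predicate is meaningful only for sufficiently regular \<open>f\<close>;
  regularity is required separately.
\<close>

definition kinetic_solution ::
  "real \<Rightarrow> (tphase \<Rightarrow> real) \<Rightarrow> (tphase \<Rightarrow> real) \<Rightarrow> (tphase \<Rightarrow> real) \<Rightarrow> bool" where
  "kinetic_solution r c S f \<longleftrightarrow>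
     (\<forall>(t, x, p) \<in> cylinder r.
        vector_derivative (\<lambda>s. f (s, x, p)) (at t within {- (r\<^sup>2)<..0})
          + (p /\<^sub>R bracket p) \<bullet> grad_x f (t, x, p)
        = trace (A p ** hess_p f (t, x, p)) + B p \<bullet> grad_p f (t, x, p)
          + c (t, x, p) * f (t, x, p) + S (t, x, p))"

definition stationary :: "(phase \<Rightarrow> 'b) \<Rightarrow> tphase \<Rightarrow> 'b" where
  "stationary g = (\<lambda>(t, z). g z)"

text \<open>Class \<open>C\<^sup>k\<close> and \<open>C\<^sup>\<infinity>\<close> on an open set \<open>U\<close>, by iterated directional derivatives.\<close>

primrec Ck_on :: "nat \<Rightarrow> 'a::real_normed_vector set \<Rightarrow> ('a \<Rightarrow> 'b::real_normed_vector) \<Rightarrow> bool" where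
  "Ck_on 0 U f \<longleftrightarrow> continuous_on U f"
| "Ck_on (Suc k) U f \<longleftrightarrow>
     (\<forall>z\<in>U. f differentiable (at z)) \<and>
     (\<forall>v. Ck_on k U (\<lambda>z. frechet_derivative f (at z) v))"

definition smooth_on :: "'a::real_normed_vector set \<Rightarrow> ('a \<Rightarrow> 'b::real_normed_vector) \<Rightarrow> bool" where
  "smooth_on U f \<longleftrightarrow> (\<forall>k. Ck_on k U f)"

text \<open>
  Extended-real valued, so that no finiteness is presupposed.  On \<^typ>\<open>real ^ 3 ^ 3\<close> the
  norm of the library is the Frobenius norm.
\<close>

definition holder_p :: "real \<Rightarrow> tphase set \<Rightarrow> (tphase \<Rightarrow> 'b::real_normed_vector) \<Rightarrow> ereal" where
  "holder_p \<alpha> Q h =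
     (SUP (t, x, p, p') \<in> {(t, x, p, p'). (t, x, p) \<in> Q \<and> (t, x, p') \<in> Q
                             \<and> 0 < norm (p - p') \<and> norm (p - p') < 1 / 2}.
        ereal (norm (h (t, x, p) - h (t, x, p')) / norm (p - p') powr \<alpha>))"

text \<open>The library's \<^const>\<open>esssup\<close> is \<open>\<infinity>\<close> for non-measurable functions.\<close>

definition Linf_norm :: "tphase set \<Rightarrow> (tphase \<Rightarrow> real) \<Rightarrow> ereal" where
  "Linf_norm Q h = esssup (lebesgue_on Q) (\<lambda>z. ereal \<bar>h z\<bar>)"

end

theory Submission
  imports Defs "HOL-Probability.Distributions"
begin

text \<open>
  The coefficients \<open>A\<close> and \<open>B\<close> are those for which the momentum operator is the flat
  Laplacian in the velocity variable \<open>v = p / \<langle>p\<rangle>\<close>.  For the first component \<open>v\<^sub>1\<close>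
  this amounts to two exact identities, \<open>\<nabla>v\<^sub>1 \<bullet> A \<nabla>v\<^sub>1 = 1\<close>
  (\<open>diffusion_of_velocity_is_one\<close>) and \<open>tr(A D\<^sup>2v\<^sub>1) + B \<bullet> \<nabla>v\<^sub>1 = 0\<close>
  (\<open>velocity_is_driftless\<close>).  Hence a function \<open>u(x\<^sub>1, v\<^sub>1)\<close> is transported and
  diffused by \<open>v\<^sub>1 \<partial>\<^sub>x u - \<partial>\<^sub>v\<^sup>2 u\<close>, with constant coefficients in the diffusion and with no
  error terms, on the whole momentum space.

  Put \<open>N = L\<^sup>3\<close>.  The scaling \<open>x\<^sub>1 \<mapsto> L\<^sup>3 x\<^sub>1\<close>, \<open>v\<^sub>1 \<mapsto> L v\<^sub>1\<close> multiplies this operator by \<open>L\<^sup>2\<close>.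
  So if \<open>U(y, \<eta>)\<close> is a bounded solution of \<open>\<eta> \<partial>\<^sub>y U - \<partial>\<^sub>\<eta>\<^sup>2 U = cos y\<close>, then
  \<open>f = 1 + L\<^sup>-\<^sup>2 U(L\<^sup>3 x\<^sub>1, L v\<^sub>1)\<close> is a stationary solution of the kinetic equation with source
  \<open>cos (L\<^sup>3 x\<^sub>1)\<close>, that is, with zero source and potential \<open>c = cos (L\<^sup>3 x\<^sub>1) / f\<close>.  The
  source does not depend on \<open>p\<close>, so \<open>c\<close> varies in \<open>p\<close> only through the small correction in \<open>f\<close>,
  whereas the factor \<open>L\<^sup>-\<^sup>2\<close> is exactly absorbed by two momentum derivatives: the Hessian of \<open>f\<close>
  has oscillations of size one at distance \<open>1 / L = N\<^sup>-\<^sup>1\<^sup>/\<^sup>3\<close>.  This gives the factor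
  \<open>L\<^sup>\<alpha>\<^sup>-\<^sup>2\<close> for \<open>c\<close> (\<open>holder_p_potential\<close>) and \<open>L\<^sup>\<alpha>\<close> for the Hessian
  (\<open>holder_p_hess_lower_bound\<close>).

  The bounded solution is obtained by letting the source act along the flow:
  \<open>U(y, \<eta>) = \<integral>\<^sub>0\<^sup>\<infinity> exp (- s\<^sup>3 / 3) cos (\<eta> s - y) ds\<close>, the real part of \<open>exp (i y)\<close> times a Scorer
  function.  Its boundedness, smoothness and equation (\<open>scorer_equation\<close>) follow from the
  integral representation.
\<close>

section \<open>Scorer integrals\<close>

definition airy_weight :: "nat \<Rightarrow> real \<Rightarrow> real" where
  "airy_weight m s = indicator {0<..} s * (s ^ m * exp (- (s ^ 3) / 3))"

definition airy_moment :: "nat \<Rightarrow> real" where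
  "airy_moment m = (LINT s|lborel. airy_weight m s)"

text \<open>
  The power \<open>s\<^sup>m\<close> in the weight and the phase \<open>\<theta>\<close> make this family closed under
  differentiation in \<open>\<eta>\<close> and in \<open>\<theta>\<close>; a derivative always shifts the phase by \<open>\<pi> / 2\<close>.
\<close>

definition scorer :: "nat \<Rightarrow> real \<Rightarrow> real \<Rightarrow> real" where
  "scorer m \<theta> \<eta> = (LINT s|lborel. airy_weight m s * cos (\<eta> * s + \<theta>))"

lemma airy_weight_nonneg: "0 \<le> airy_weight m s"
  by (auto simp: airy_weight_def indicator_def)

lemma airy_weight_measurable [measurable]: "airy_weight m \<in> borel_measurable lborel"
  unfolding airy_weight_def by measurable

text \<open>
  The cubic exponential is dominated by a multiple of \<open>exp (- s)\<close>, whose moments are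
  factorials.
\<close>

lemma airy_weight_integrable: "integrable lborel (airy_weight m)"
proof (rule Bochner_Integration.integrable_bound)
  show "integrable lborel (\<lambda>s. exp 1 * (s ^ m * exp (- s) * indicator {0..} s) :: real)"
  proof (intro integrable_mult_right integrableI_nonneg)
    have "(\<integral>\<^sup>+ s. ennreal (s ^ m * exp (- s) * indicator {0..} s) \<partial>lborel)
        = (\<integral>\<^sup>+ s. ennreal (s ^ m * exp (- s)) * indicator {0..} s \<partial>lborel)"
      by (intro nn_integral_cong) (auto simp: indicator_def)
    then show "(\<integral>\<^sup>+ s. ennreal (s ^ m * exp (- s) * indicator {0..} s) \<partial>lborel) < \<infinity>"
      by (simp add: nn_intergal_power_times_exp_Ici)
  qed (auto simp: indicator_def)
  show "AE s in lborel. norm (airy_weight m s)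
      \<le> norm (exp 1 * (s ^ m * exp (- s) * indicator {0..} s))"
  proof (rule AE_I2)
    fix s :: real
    have "exp (- (s ^ 3) / 3) \<le> exp (1 - s)" if "0 < s"
    proof -
      \<comment> \<open>\<open>s\<^sup>3 - 3 s + 2 = (s - 1)\<^sup>2 (s + 2)\<close>\<close>
      have "0 \<le> (s - 1)\<^sup>2 * (s + 2)" using that by simp
      then show ?thesis by (simp add: power2_eq_square power3_eq_cube algebra_simps)
    qed
    then show "norm (airy_weight m s) \<le> norm (exp 1 * (s ^ m * exp (- s) * indicator {0..} s))"
      by (auto simp: airy_weight_def indicator_def exp_diff exp_minus field_simps)
  qed
qed simp

lemma scorer_integrable: "integrable lborel (\<lambda>s. airy_weight m s * cos (\<eta> * s + \<theta>))"
proof (rule Bochner_Integration.integrable_bound[OF airy_weight_integrable[of m]])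
  show "AE s in lborel. norm (airy_weight m s * cos (\<eta> * s + \<theta>)) \<le> norm (airy_weight m s)"
    by (auto simp: abs_mult intro!: mult_left_le abs_cos_le_one)
qed simp

lemma airy_moment_nonneg: "0 \<le> airy_moment m"
  unfolding airy_moment_def by (simp add: airy_weight_nonneg)

lemma abs_scorer_le: "\<bar>scorer m \<theta> \<eta>\<bar> \<le> airy_moment m"
proof -
  have "\<bar>scorer m \<theta> \<eta>\<bar> \<le> (LINT s|lborel. \<bar>airy_weight m s * cos (\<eta> * s + \<theta>)\<bar>)"
    unfolding scorer_def by (rule integral_abs_bound)
  also have "\<dots> \<le> airy_moment m"
    unfolding airy_moment_def
    by (intro integral_mono integrable_abs scorer_integrable airy_weight_integrable)
      (auto simp: abs_mult airy_weight_nonneg intro!: mult_left_le abs_cos_le_one)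
  finally show ?thesis .
qed

text \<open>
  Separating the phase from \<open>\<eta>\<close> reduces joint regularity in \<open>(\<theta>, \<eta>)\<close> to regularity in each
  single variable.
\<close>

lemma scorer_phase:
  "scorer m \<theta> \<eta> = cos \<theta> * scorer m 0 \<eta> + sin \<theta> * scorer m (pi / 2) \<eta>"
proof -
  have "scorer m \<theta> \<eta> = (LINT s|lborel. cos \<theta> * (airy_weight m s * cos (\<eta> * s + 0))
        + sin \<theta> * (airy_weight m s * cos (\<eta> * s + pi / 2)))"
    unfolding scorer_def
    by (intro Bochner_Integration.integral_cong refl) (simp add: cos_add algebra_simps)
  also have "\<dots> = cos \<theta> * scorer m 0 \<eta> + sin \<theta> * scorer m (pi / 2) \<eta>"
    unfolding scorer_def
    by (simp only: Bochner_Integration.integral_add Bochner_Integration.integrable_mult_right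
        scorer_integrable Bochner_Integration.integral_mult_right_zero)
  finally show ?thesis .
qed

lemma scorer_add_pi: "scorer m (\<theta> + pi) \<eta> = - scorer m \<theta> \<eta>"
  by (subst (1 2) scorer_phase) simp

lemma DERIV_scorer_phase:
  "((\<lambda>\<theta>. scorer m \<theta> \<eta>) has_real_derivative scorer m (\<theta> + pi / 2) \<eta>) (at \<theta>)"
  by (subst (1 2) scorer_phase)
    (auto intro!: derivative_eq_intros simp: cos_add sin_add)

lemma abs_cos_taylor: "\<bar>cos (x + y) - cos x - y * cos (x + pi / 2)\<bar> \<le> y\<^sup>2" for x y :: real
proof -
  have "\<bar>cos (x + y) - cos x + y * sin x\<bar> \<le> \<bar>y\<bar> * \<bar>y\<bar>"
  proof -
    have "norm ((cos (x + y) + (x + y) * sin x) - (cos x + x * sin x)) \<le> \<bar>y\<bar> * norm ((x + y) - x)"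
    proof (rule field_differentiable_bound[where S = "closed_segment x (x + y)"
          and f' = "\<lambda>t. sin x - sin t"])
      fix t assume t: "t \<in> closed_segment x (x + y)"
      show "((\<lambda>t. cos t + t * sin x) has_field_derivative (sin x - sin t))
          (at t within closed_segment x (x + y))"
        by (auto intro!: derivative_eq_intros)
      have "\<bar>sin x - sin t\<bar> \<le> \<bar>x - t\<bar>"
        using abs_sin_x_le_abs_x[of "(x - t) / 2"] abs_cos_le_one[of "(x + t) / 2"]
          mult_mono[of "\<bar>sin ((x - t) / 2)\<bar>" "\<bar>(x - t) / 2\<bar>" "\<bar>cos ((x + t) / 2)\<bar>" 1]
        by (simp add: sin_diff_sin abs_mult)
      also have "\<dots> \<le> \<bar>y\<bar>" using t by (auto simp: closed_segment_eq_real_ivl split: if_splits)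
      finally show "norm (sin x - sin t) \<le> \<bar>y\<bar>" by simp
    qed auto
    then show ?thesis by (simp add: algebra_simps)
  qed
  then show ?thesis by (simp add: cos_add power2_eq_square)
qed

text \<open>
  Differentiation under the integral sign: the second-order Taylor remainder of the cosine
  is at most \<open>(h s)\<^sup>2\<close>, and its integral against the weight is a finite moment.
\<close>

lemma DERIV_scorer:
  "(scorer m \<theta> has_real_derivative scorer (Suc m) (\<theta> + pi / 2) \<eta>) (at \<eta>)"
proof -
  have bound: "\<bar>scorer m \<theta> (\<eta> + h) - scorer m \<theta> \<eta> - h * scorer (Suc m) (\<theta> + pi / 2) \<eta>\<bar>
      \<le> h\<^sup>2 * airy_moment (m + 2)" for h
  proof -
    let ?r = "\<lambda>s. airy_weight m s * cos ((\<eta> + h) * s + \<theta>) - airy_weight m s * cos (\<eta> * s + \<theta>)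
        - h * (airy_weight (Suc m) s * cos (\<eta> * s + (\<theta> + pi / 2)))"
    have int: "integrable lborel ?r"
      by (intro Bochner_Integration.integrable_diff Bochner_Integration.integrable_mult_right
          scorer_integrable)
    have "scorer m \<theta> (\<eta> + h) - scorer m \<theta> \<eta> - h * scorer (Suc m) (\<theta> + pi / 2) \<eta> = integral\<^sup>L lborel ?r"
      unfolding scorer_def
      by (simp only: Bochner_Integration.integral_diff Bochner_Integration.integrable_diff
        Bochner_Integration.integrable_mult_right
        scorer_integrable Bochner_Integration.integral_mult_right_zero)
    moreover have "\<bar>integral\<^sup>L lborel ?r\<bar> \<le> (LINT s|lborel. \<bar>?r s\<bar>)"
      by (rule integral_abs_bound)
    moreover have "(LINT s|lborel. \<bar>?r s\<bar>) \<le> (LINT s|lborel. h\<^sup>2 * airy_weight (m + 2) s)"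
    proof (intro integral_mono integrable_abs int Bochner_Integration.integrable_mult_right
        airy_weight_integrable)
      fix s
      have "?r s = airy_weight m s * (cos ((\<eta> * s + \<theta>) + h * s) - cos (\<eta> * s + \<theta>)
          - (h * s) * cos ((\<eta> * s + \<theta>) + pi / 2))"
        by (simp add: airy_weight_def algebra_simps)
      then have "\<bar>?r s\<bar> \<le> airy_weight m s * (h * s)\<^sup>2"
        using mult_left_mono[OF abs_cos_taylor[of "\<eta> * s + \<theta>" "h * s"] airy_weight_nonneg[of m s]]
        by (simp add: abs_mult airy_weight_nonneg)
      also have "\<dots> = h\<^sup>2 * airy_weight (m + 2) s"
        by (simp add: airy_weight_def power2_eq_square)
      finally show "\<bar>?r s\<bar> \<le> h\<^sup>2 * airy_weight (m + 2) s" .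
    qed
    ultimately have "\<bar>scorer m \<theta> (\<eta> + h) - scorer m \<theta> \<eta> - h * scorer (Suc m) (\<theta> + pi / 2) \<eta>\<bar>
        \<le> (LINT s|lborel. h\<^sup>2 * airy_weight (m + 2) s)"
      by linarith
    then show ?thesis by (simp add: airy_moment_def)
  qed
  have "(\<lambda>h. (scorer m \<theta> (\<eta> + h) - scorer m \<theta> \<eta>) / h) \<midarrow>0\<rightarrow> scorer (Suc m) (\<theta> + pi / 2) \<eta>"
  proof (rule LIM_I)
    fix e :: real assume e: "0 < e"
    let ?M = "airy_moment (m + 2) + 1"
    have M: "0 < ?M" using airy_moment_nonneg[of "m + 2"] by simp
    show "\<exists>d>0. \<forall>h. h \<noteq> 0 \<and> norm (h - 0) < d \<longrightarrow>
        norm ((scorer m \<theta> (\<eta> + h) - scorer m \<theta> \<eta>) / h - scorer (Suc m) (\<theta> + pi / 2) \<eta>) < e"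
    proof (intro exI[of _ "e / ?M"] conjI allI impI)
      fix h :: real assume h: "h \<noteq> 0 \<and> norm (h - 0) < e / ?M"
      have "\<bar>(scorer m \<theta> (\<eta> + h) - scorer m \<theta> \<eta>) / h - scorer (Suc m) (\<theta> + pi / 2) \<eta>\<bar>
          = \<bar>scorer m \<theta> (\<eta> + h) - scorer m \<theta> \<eta> - h * scorer (Suc m) (\<theta> + pi / 2) \<eta>\<bar> / \<bar>h\<bar>"
        using h by (simp add: diff_divide_distrib flip: abs_divide)
      also have "\<dots> \<le> h\<^sup>2 * airy_moment (m + 2) / \<bar>h\<bar>"
        by (intro divide_right_mono bound) simp
      also have "\<dots> = \<bar>h\<bar> * airy_moment (m + 2)"
        using h by (simp add: field_simps flip: power2_eq_square)
      also have "\<dots> < \<bar>h\<bar> * ?M" using h by simp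
      also have "\<dots> < e" using h M by (simp add: field_simps)
      finally show "norm ((scorer m \<theta> (\<eta> + h) - scorer m \<theta> \<eta>) / h
          - scorer (Suc m) (\<theta> + pi / 2) \<eta>) < e" by simp
    qed (use e M in simp)
  qed
  then show ?thesis by (simp add: DERIV_def)
qed

text \<open>
  The integrand on the left is the derivative in \<open>s\<close> of
  \<open>- exp (- s\<^sup>3 / 3) cos (\<eta> s + \<theta>)\<close>, which vanishes at infinity.  With \<open>\<theta> = - y\<close> this is the
  equation \<open>\<eta> \<partial>\<^sub>y U - \<partial>\<^sub>\<eta>\<^sup>2 U = cos y\<close>.
\<close>

lemma scorer_equation:
  "scorer 2 \<theta> \<eta> - \<eta> * scorer 0 (\<theta> + pi / 2) \<eta> = cos \<theta>"
proof -
  let ?F = "\<lambda>s. - (exp (- (s ^ 3) / 3) * cos (\<eta> * s + \<theta>))"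
  let ?f = "\<lambda>s. s\<^sup>2 * exp (- (s ^ 3) / 3) * cos (\<eta> * s + \<theta>)
     - \<eta> * (exp (- (s ^ 3) / 3) * cos (\<eta> * s + (\<theta> + pi / 2)))"
  have f: "indicator {0<..} s *\<^sub>R ?f s = airy_weight 2 s * cos (\<eta> * s + \<theta>)
     - \<eta> * (airy_weight 0 s * cos (\<eta> * s + (\<theta> + pi / 2)))" for s
    by (simp add: airy_weight_def algebra_simps)
  have ev: "einterval 0 \<infinity> = {0::real<..}" by (auto simp: einterval_def)
  have int: "set_integrable lborel (einterval 0 \<infinity>) ?f"
    unfolding set_integrable_def ev f
    by (intro Bochner_Integration.integrable_diff Bochner_Integration.integrable_mult_right
        scorer_integrable)
  have "(LBINT s=0..\<infinity>. ?f s) = 0 - (- cos \<theta>)"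
  proof (rule interval_integral_FTC_integrable[OF _ _ _ int, where F = ?F])
    show "(?F has_vector_derivative ?f s) (at s)" for s
      unfolding has_real_derivative_iff_has_vector_derivative[symmetric]
      by (auto intro!: derivative_eq_intros simp: cos_add sin_add algebra_simps)
    have "(?F \<longlongrightarrow> ?F 0) (at_right 0)"
      by (intro tendsto_intros) auto
    then show "((?F \<circ> real_of_ereal) \<longlongrightarrow> - cos \<theta>) (at_right 0)"
      by (simp add: zero_ereal_def ereal_tendsto_simps1)
    have "((\<lambda>s. exp (- (s ^ 3) / 3) * cos (\<eta> * s + \<theta>)) \<longlongrightarrow> 0) at_top"
    proof (rule Lim_null_comparison)
      show "\<forall>\<^sub>F s in at_top. norm (exp (- (s ^ 3) / 3) * cos (\<eta> * s + \<theta>)) \<le> exp (- (s ^ 3) / 3)"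
        by (intro always_eventually) (auto simp: abs_mult intro!: mult_left_le abs_cos_le_one)
      show "((\<lambda>s::real. exp (- (s ^ 3) / 3)) \<longlongrightarrow> 0) at_top"
        by real_asymp
    qed
    from tendsto_minus[OF this] show "((?F \<circ> real_of_ereal) \<longlongrightarrow> 0) (at_left \<infinity>)"
      by (simp add: ereal_tendsto_simps1)
  qed auto
  moreover have "(LBINT s=0..\<infinity>. ?f s) = scorer 2 \<theta> \<eta> - \<eta> * scorer 0 (\<theta> + pi / 2) \<eta>"
    unfolding interval_lebesgue_integral_def set_lebesgue_integral_def ev f scorer_def
    by (simp add: Bochner_Integration.integral_diff scorer_integrable)
  ultimately show ?thesis by simp
qed

text \<open>
  At \<open>\<tau> = 0\<close> the value is \<open>- 1\<close>.  It cannot persist, since \<open>scorer 2 \<pi>\<close> is the derivative of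
  the bounded function \<open>scorer 1 (\<pi> / 2)\<close>.  This is the oscillation that the Hessian of the
  solution inherits.
\<close>

lemma scorer_second_moment_varies: "\<exists>\<tau>>0. scorer 2 pi \<tau> \<noteq> -1"
proof -
  define t where "t = 2 * airy_moment 1 + 1"
  have t: "0 < t" using airy_moment_nonneg[of 1] by (simp add: t_def)
  have "\<exists>\<tau>>0. \<tau> < t \<and> scorer 1 (pi / 2) t - scorer 1 (pi / 2) 0 = (t - 0) * scorer 2 pi \<tau>"
    using MVT2[OF t, of "scorer 1 (pi / 2)" "scorer 2 pi"] DERIV_scorer[of 1 "pi / 2"]
    by (auto simp: numeral_2_eq_2)
  then obtain \<tau> where \<tau>: "\<tau> > 0" "scorer 1 (pi / 2) t - scorer 1 (pi / 2) 0 = t * scorer 2 pi \<tau>"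
    by auto
  have "\<bar>scorer 1 (pi / 2) t - scorer 1 (pi / 2) 0\<bar> < t"
    using abs_scorer_le[of 1 "pi / 2" t] abs_scorer_le[of 1 "pi / 2" 0] by (simp add: t_def)
  then have "scorer 2 pi \<tau> \<noteq> -1" using \<tau>(2) t by auto
  then show ?thesis using \<tau>(1) by blast
qed

section \<open>Functions of class \<open>C\<^sup>k\<close>\<close>

lemma Ck_on_cong:
  assumes "open U" "Ck_on k U f" "\<And>z. z \<in> U \<Longrightarrow> f z = g z"
  shows "Ck_on k U g"
  using assms(2,3)
proof (induction k arbitrary: f g)
  case 0
  then show ?case using continuous_on_cong[of U U f g] by simp
next
  case (Suc k)
  have g: "(g has_derivative frechet_derivative f (at z)) (at z)" if "z \<in> U" for z
  proof (rule has_derivative_transform_within_open[OF _ \<open>open U\<close> that])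
    show "(f has_derivative frechet_derivative f (at z)) (at z)"
      using Suc.prems(1) that by (simp add: frechet_derivative_works)
  qed (use Suc.prems(2) in auto)
  have "Ck_on k U (\<lambda>z. frechet_derivative g (at z) v)" for v
  proof (rule Suc.IH)
    show "Ck_on k U (\<lambda>z. frechet_derivative f (at z) v)" using Suc.prems(1) by simp
    show "frechet_derivative f (at z) v = frechet_derivative g (at z) v" if "z \<in> U" for z
      using frechet_derivative_at[OF g[OF that]] by simp
  qed
  then show ?case using g by (auto simp: differentiable_def)
qed

text \<open>
  This form of the recursion accepts any formula for the derivative, so that the closure
  properties below need no computation of \<open>frechet_derivative\<close>.
\<close>

lemma Ck_on_Suc:
  assumes "open U"
    and D: "\<And>z. z \<in> U \<Longrightarrow> (f has_derivative D z) (at z)"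
    and "\<And>v. Ck_on k U (\<lambda>z. D z v)"
  shows "Ck_on (Suc k) U f"
proof -
  have "Ck_on k U (\<lambda>z. frechet_derivative f (at z) v)" for v
    by (rule Ck_on_cong[OF assms(1) assms(3)[of v]]) (simp add: frechet_derivative_at[OF D, symmetric])
  then show ?thesis using D by (auto simp: differentiable_def)
qed

lemma Ck_on_has_derivative:
  "Ck_on (Suc k) U f \<Longrightarrow> z \<in> U \<Longrightarrow> (f has_derivative frechet_derivative f (at z)) (at z)"
  by (simp add: frechet_derivative_works)

lemma Ck_on_lower: "Ck_on (Suc k) U f \<Longrightarrow> Ck_on k U f"
proof (induction k arbitrary: f)
  case 0
  then show ?case
    by (auto intro!: continuous_at_imp_continuous_on differentiable_imp_continuous_within)
next
  case (Suc k)
  then show ?case by (metis Ck_on.simps(2))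
qed

lemma Ck_on_const: "open U \<Longrightarrow> Ck_on k U (\<lambda>_. a)"
  by (induction k arbitrary: a) (auto intro!: Ck_on_Suc)

lemma Ck_on_bounded_linear:
  assumes "open U" "bounded_linear h" shows "Ck_on k U h"
proof (cases k)
  case 0
  then show ?thesis using linear_continuous_on[OF assms(2)] by simp
next
  case (Suc j)
  show ?thesis unfolding Suc
    by (rule Ck_on_Suc[OF \<open>open U\<close> bounded_linear_imp_has_derivative[OF assms(2)]])
      (auto intro: Ck_on_const \<open>open U\<close>)
qed

lemma Ck_on_add:
  assumes "open U" "Ck_on k U f" "Ck_on k U g"
  shows "Ck_on k U (\<lambda>z. f z + g z)"
  using assms(2,3)
proof (induction k arbitrary: f g)
  case (Suc k)
  show ?case
    by (rule Ck_on_Suc[OF \<open>open U\<close> has_derivative_add[OF Suc.prems[THEN Ck_on_has_derivative]]])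
      (use Suc in auto)
qed (simp add: continuous_on_add)

lemma Ck_on_mult:
  fixes f g :: "'a::real_normed_vector \<Rightarrow> real"
  assumes "open U" "Ck_on k U f" "Ck_on k U g"
  shows "Ck_on k U (\<lambda>z. f z * g z)"
  using assms(2,3)
proof (induction k arbitrary: f g)
  case (Suc k)
  show ?case
    by (rule Ck_on_Suc[OF \<open>open U\<close> has_derivative_mult[OF Suc.prems[THEN Ck_on_has_derivative]]])
      (use Suc Suc.prems[THEN Ck_on_lower] in \<open>auto intro!: Ck_on_add \<open>open U\<close>\<close>)
qed (simp add: continuous_on_mult)

text \<open>
  The outer function is given together with all its derivatives: \<open>G n\<close> is the \<open>n\<close>-th derivative
  of \<open>G 0\<close>.  The induction has to range over all \<open>n\<close>, since the chain rule produces
  \<open>G (Suc n)\<close>.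
\<close>

lemma Ck_on_compose_real:
  fixes h :: "'a::real_normed_vector \<Rightarrow> real" and G :: "nat \<Rightarrow> real \<Rightarrow> real"
  assumes "open U" "Ck_on k U h"
    and "\<And>n z. z \<in> U \<Longrightarrow> (G n has_real_derivative G (Suc n) (h z)) (at (h z))"
  shows "Ck_on k U (\<lambda>z. G n (h z))"
  using assms(2)
proof (induction k arbitrary: n)
  case 0
  then have h: "continuous_on U h" by simp
  have "continuous (at z within U) (\<lambda>z. G n (h z))" if "z \<in> U" for z
    using continuous_within_compose3[where g = "G n" and f = h, OF DERIV_isCont[OF assms(3)[OF that]]] h that
    by (simp add: continuous_on_eq_continuous_within)
  then show ?case by (simp add: continuous_on_eq_continuous_within)
next
  case (Suc k)
  have "((\<lambda>z. G n (h z)) has_derivative (\<lambda>v. frechet_derivative h (at z) v * G (Suc n) (h z))) (at z)"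
    if "z \<in> U" for z
    using DERIV_compose_FDERIV[OF assms(3)[OF that] Ck_on_has_derivative[OF Suc.prems that]] .
  then show ?case
    by (rule Ck_on_Suc[OF \<open>open U\<close>])
      (use Suc Ck_on_lower[OF Suc.prems] in \<open>auto intro!: Ck_on_mult \<open>open U\<close>\<close>)
qed

lemma smooth_on_const: "open U \<Longrightarrow> smooth_on U (\<lambda>_. a)"
  and smooth_on_bounded_linear: "open U \<Longrightarrow> bounded_linear h \<Longrightarrow> smooth_on U h"
  and smooth_on_add: "open U \<Longrightarrow> smooth_on U f \<Longrightarrow> smooth_on U g \<Longrightarrow> smooth_on U (\<lambda>z. f z + g z)"
  unfolding smooth_on_def by (simp_all add: Ck_on_const Ck_on_bounded_linear Ck_on_add)

lemma smooth_on_mult: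
  fixes f g :: "'a::real_normed_vector \<Rightarrow> real"
  shows "open U \<Longrightarrow> smooth_on U f \<Longrightarrow> smooth_on U g \<Longrightarrow> smooth_on U (\<lambda>z. f z * g z)"
  unfolding smooth_on_def by (simp add: Ck_on_mult)

lemma smooth_on_compose_real:
  fixes h :: "'a::real_normed_vector \<Rightarrow> real" and G :: "nat \<Rightarrow> real \<Rightarrow> real"
  assumes "open U" "smooth_on U h"
    and "\<And>n z. z \<in> U \<Longrightarrow> (G n has_real_derivative G (Suc n) (h z)) (at (h z))"
  shows "smooth_on U (\<lambda>z. G n (h z))"
  using assms Ck_on_compose_real unfolding smooth_on_def by blast

lemma smooth_on_powr:
  fixes h :: "'a::real_normed_vector \<Rightarrow> real"
  assumes "open U" "smooth_on U h" "\<And>z. z \<in> U \<Longrightarrow> 0 < h z"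
  shows "smooth_on U (\<lambda>z. h z powr a)"
proof -
  have "smooth_on U (\<lambda>z. (\<Prod>i<0. a - real i) * h z powr (a - real 0))"
    by (rule smooth_on_compose_real[OF assms(1,2), where G = "\<lambda>n t. (\<Prod>i<n. a - real i) * t powr (a - real n)"])
      (use DERIV_cmult[OF has_real_derivative_powr[OF assms(3)], of _ "\<Prod>i<_. a - real i" "a - real _"]
        in \<open>simp add: mult.assoc algebra_simps\<close>)
  then show ?thesis by simp
qed

lemma smooth_on_cos:
  fixes h :: "'a::real_normed_vector \<Rightarrow> real"
  assumes "open U" "smooth_on U h"
  shows "smooth_on U (\<lambda>z. cos (h z + b))"
proof -
  have shift: "cos (t + b + (1 + real n) * pi / 2) = - sin (t + b + real n * pi / 2)" for t n
    using cos_add[of "t + b + real n * pi / 2" "pi / 2"] by (simp add: algebra_simps add_divide_distrib)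
  have "smooth_on U (\<lambda>z. cos (h z + b + real 0 * pi / 2))"
    by (rule smooth_on_compose_real[OF assms, where G = "\<lambda>n t. cos (t + b + real n * pi / 2)"])
      (auto intro!: derivative_eq_intros simp: shift)
  then show ?thesis by simp
qed

section \<open>The momentum operator in the velocity variable\<close>

text \<open>
  Only the first component of the relativistic velocity \<open>p / \<langle>p\<rangle>\<close> is needed, because the
  solution oscillates in the direction of \<open>x\<^sub>1\<close> alone.
\<close>

definition velocity :: "real ^ 3 \<Rightarrow> real" where
  "velocity p = p $ 1 / bracket p"

definition grad_velocity :: "real ^ 3 \<Rightarrow> real ^ 3" where
  "grad_velocity p = (1 / bracket p) *\<^sub>R axis 1 1 - (p $ 1 / bracket p ^ 3) *\<^sub>R p"

definition hess_velocity :: "real ^ 3 \<Rightarrow> real ^ 3 ^ 3" where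
  "hess_velocity p =
     (3 * p $ 1 / bracket p ^ 5) *\<^sub>R tensor p p
     - (1 / bracket p ^ 3) *\<^sub>R (tensor p (axis 1 1) + tensor (axis 1 1) p + mat (p $ 1))"

lemma bracket_ge_1: "1 \<le> bracket p"
  by (simp add: bracket_def)

lemma bracket_pos: "0 < bracket p" and bracket_nz [simp]: "bracket p \<noteq> 0"
  using bracket_ge_1[of p] by auto

lemma bracket_sq: "(bracket p)\<^sup>2 = 1 + p \<bullet> p"
  by (simp add: bracket_def power2_norm_eq_inner)

lemma has_derivative_bracket:
  "(bracket has_derivative (\<lambda>v. (p \<bullet> v) / bracket p)) (at p)"
proof -
  have "0 < 1 + p \<bullet> p" using inner_ge_zero[of p] by linarith
  then have "((\<lambda>p. sqrt (1 + p \<bullet> p)) has_derivative (\<lambda>v. (p \<bullet> v) / sqrt (1 + p \<bullet> p))) (at p)"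
    by (auto intro!: derivative_eq_intros simp: inner_commute field_simps)
  moreover have "bracket = (\<lambda>p. sqrt (1 + p \<bullet> p))"
    by (simp add: bracket_def power2_norm_eq_inner fun_eq_iff)
  ultimately show ?thesis by metis
qed

lemma has_derivative_velocity:
  "(velocity has_derivative (\<lambda>v. grad_velocity p \<bullet> v)) (at p)"
proof -
  have "((\<lambda>p. p $ 1 / bracket p) has_derivative (\<lambda>v. grad_velocity p \<bullet> v)) (at p)"
    by (rule has_derivative_eq_rhs[OF has_derivative_divide'[OF
          bounded_linear_imp_has_derivative[OF bounded_linear_vec_nth] has_derivative_bracket bracket_nz]])
      (simp add: grad_velocity_def inner_diff_left inner_axis' fun_eq_iff field_simps eval_nat_numeral)
  then show ?thesis by (simp only: velocity_def[abs_def])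
qed

lemma has_derivative_grad_velocity:
  "((\<lambda>q. grad_velocity q $ j) has_derivative (\<lambda>v. (hess_velocity p *v axis j 1) \<bullet> v)) (at p)"
proof -
  have "hess_velocity p *v axis j 1 =
     (3 * p $ 1 * p $ j / bracket p ^ 5) *\<^sub>R p
     - (1 / bracket p ^ 3) *\<^sub>R (axis 1 1 $ j *\<^sub>R p + p $ j *\<^sub>R axis 1 1 + p $ 1 *\<^sub>R axis j 1)"
    unfolding matrix_vector_mult_basis
    by (auto simp: column_def hess_velocity_def tensor_def mat_def axis_def vec_eq_iff)
  then have rhs: "(hess_velocity p *v axis j 1) \<bullet> v =
     3 * p $ 1 * p $ j * (p \<bullet> v) / bracket p ^ 5
     - (axis 1 1 $ j * (p \<bullet> v) + p $ j * v $ 1 + p $ 1 * v $ j) / bracket p ^ 3" for v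
    by (simp add: inner_diff_left inner_add_left inner_axis')
  have "((\<lambda>q. axis 1 1 $ j / bracket q - q $ 1 * q $ j / bracket q ^ 3) has_derivative
      (\<lambda>v. (hess_velocity p *v axis j 1) \<bullet> v)) (at p)"
    by (rule has_derivative_eq_rhs[OF has_derivative_diff[OF
          has_derivative_divide'[OF has_derivative_const has_derivative_bracket bracket_nz]
          has_derivative_divide'[OF has_derivative_mult[OF
            bounded_linear_imp_has_derivative[OF bounded_linear_vec_nth]
            bounded_linear_imp_has_derivative[OF bounded_linear_vec_nth]]
            has_derivative_power[OF has_derivative_bracket]]]])
      (simp_all add: rhs fun_eq_iff field_simps eval_nat_numeral)
  then show ?thesis by (simp add: grad_velocity_def)
qed

lemma inner_self: "p \<bullet> p = (bracket p)\<^sup>2 - 1"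
  by (simp add: bracket_sq)

text \<open>
  Since \<open>(p \<otimes> p)\<^sup>2 = \<bar>p\<bar>\<^sup>2 p \<otimes> p\<close>, the matrix \<open>A\<close> is \<open>\<langle>p\<rangle>\<^sup>2 (Id + (1 + \<langle>p\<rangle>\<^sup>2) p \<otimes> p)\<close>, and a
  trace against it only involves the trace and the radial quadratic form of \<open>H\<close>.  For the matrices
  below both are rational functions of \<open>p\<^sub>1\<close> and \<open>\<langle>p\<rangle>\<close>.
\<close>

lemma trace_A_mult:
  "trace (A p ** H) = (bracket p)\<^sup>2 * (trace H + (1 + (bracket p)\<^sup>2) * (p \<bullet> (H *v p)))"
proof -
  have "(mat 1 + tensor p p) ** (mat 1 + tensor p p) = mat 1 + (2 + p \<bullet> p) *\<^sub>R tensor p p"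
    by (simp add: vec_eq_iff forall_3 matrix_matrix_mult_def tensor_def mat_def inner_vec_def sum_3)
      (simp add: algebra_simps)
  then have "A p = (bracket p)\<^sup>2 *\<^sub>R (mat 1 + (1 + (bracket p)\<^sup>2) *\<^sub>R tensor p p)"
    by (simp add: A_def inner_self)
  then show ?thesis
    by (simp add: trace_def matrix_matrix_mult_def matrix_vector_mult_def tensor_def mat_def
        inner_vec_def sum_3) (simp add: algebra_simps)
qed

lemma inner_grad_velocity: "p \<bullet> grad_velocity p = p $ 1 / bracket p ^ 3"
  by (simp add: grad_velocity_def inner_diff_right inner_axis inner_self[of p])
    (simp add: field_simps eval_nat_numeral)

text \<open>
  Conceptually, \<open>(Id + p \<otimes> p) \<nabla>v\<^sub>1 = e\<^sub>1 / \<langle>p\<rangle>\<close>, and \<open>A\<close> is \<open>\<langle>p\<rangle>\<^sup>2\<close> times the square of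
  \<open>Id + p \<otimes> p\<close>.
\<close>

lemma diffusion_of_velocity_is_one:
  "trace (A p ** tensor (grad_velocity p) (grad_velocity p)) = 1"
proof -
  have "trace (tensor g g) = g \<bullet> g" "p \<bullet> (tensor g g *v p) = (p \<bullet> g)\<^sup>2" for g
    by (simp_all add: trace_def tensor_def matrix_vector_mult_def inner_vec_def sum_3
        power2_eq_square algebra_simps)
  moreover have "grad_velocity p \<bullet> grad_velocity p =
      1 / (bracket p)\<^sup>2 - 2 * (p $ 1)\<^sup>2 / bracket p ^ 4 + (p $ 1)\<^sup>2 * ((bracket p)\<^sup>2 - 1) / bracket p ^ 6"
    by (simp add: grad_velocity_def inner_diff_left inner_diff_right inner_axis inner_axis' inner_self[of p])
      (simp add: field_simps eval_nat_numeral)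
  ultimately show ?thesis
    by (simp add: trace_A_mult inner_grad_velocity) (simp add: field_simps eval_nat_numeral)
qed

text \<open>
  The summands are \<open>\<mp> p\<^sub>1 (5 + 3 \<bar>p\<bar>\<^sup>2) / \<langle>p\<rangle>\<close>; the drift \<open>B\<close> is
  exactly the one that cancels the second-order term.
\<close>

lemma velocity_is_driftless:
  "trace (A p ** hess_velocity p) + B p \<bullet> grad_velocity p = 0"
proof -
  let ?b = "bracket p"
  have tr: "trace (hess_velocity p) = 3 * p $ 1 * (p \<bullet> p) / ?b ^ 5 - 5 * p $ 1 / ?b ^ 3"
    by (simp add: trace_def hess_velocity_def tensor_def mat_def axis_def inner_vec_def sum_3)
      (simp add: add_divide_distrib algebra_simps)
  have Hp: "hess_velocity p *v p =
      (3 * p $ 1 * (p \<bullet> p) / ?b ^ 5) *\<^sub>R p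
      - (1 / ?b ^ 3) *\<^sub>R (p $ 1 *\<^sub>R p + (p \<bullet> p) *\<^sub>R axis 1 1 + p $ 1 *\<^sub>R p)"
    by (simp add: hess_velocity_def tensor_def mat_def axis_def inner_vec_def sum_3
        matrix_vector_mult_def vec_eq_iff forall_3) (simp add: add_divide_distrib algebra_simps)
  have quad: "p \<bullet> (hess_velocity p *v p) =
      3 * p $ 1 * (p \<bullet> p)\<^sup>2 / ?b ^ 5 - 3 * p $ 1 * (p \<bullet> p) / ?b ^ 3"
    unfolding Hp inner_diff_right inner_add_right inner_scaleR_right inner_axis
    by (simp add: power2_eq_square add_divide_distrib algebra_simps)
  have "B p \<bullet> grad_velocity p = (3 * ?b ^ 4 + 2 * ?b\<^sup>2) * (p $ 1 / ?b ^ 3)"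
    by (simp add: B_def inner_grad_velocity)
  then show ?thesis
    by (simp add: trace_A_mult tr quad inner_self) (simp add: field_simps eval_nat_numeral)
qed

lemma grad_eqI:
  assumes "(h has_derivative (\<lambda>v. g \<bullet> v)) (at p)" shows "grad h p = g"
  using frechet_derivative_at[OF assms, symmetric] by (simp add: grad_def inner_axis vec_eq_iff)

lemma grad_compose_velocity:
  assumes "(u has_real_derivative u') (at (velocity p))"
  shows "grad (\<lambda>q. u (velocity q)) p = u' *\<^sub>R grad_velocity p"
  by (rule grad_eqI)
    (use DERIV_compose_FDERIV[OF assms has_derivative_velocity] in \<open>simp add: mult.commute\<close>)

text \<open>
  The two terms are those which the identities above evaluate: after tracing against \<open>A\<close>, the
  first gives \<open>u''\<close> and the second is cancelled by the drift.
\<close>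

lemma hess_compose_velocity:
  assumes "\<And>s. (u has_real_derivative u' s) (at s)" "\<And>s. (u' has_real_derivative u'' s) (at s)"
  shows "hess (\<lambda>q. u (velocity q)) p =
     u'' (velocity p) *\<^sub>R tensor (grad_velocity p) (grad_velocity p)
     + u' (velocity p) *\<^sub>R hess_velocity p"
proof -
  have "grad (\<lambda>q. u' (velocity q) * grad_velocity q $ j) p =
      (u'' (velocity p) * grad_velocity p $ j) *\<^sub>R grad_velocity p
      + u' (velocity p) *\<^sub>R (hess_velocity p *v axis j 1)" for j
  proof (rule grad_eqI)
    show "((\<lambda>q. u' (velocity q) * grad_velocity q $ j) has_derivative
        (\<lambda>v. ((u'' (velocity p) * grad_velocity p $ j) *\<^sub>R grad_velocity p
      + u' (velocity p) *\<^sub>R (hess_velocity p *v axis j 1)) \<bullet> v)) (at p)"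
      by (rule has_derivative_eq_rhs[OF has_derivative_mult[OF
            DERIV_compose_FDERIV[OF assms(2) has_derivative_velocity] has_derivative_grad_velocity]])
        (auto simp: fun_eq_iff inner_add_left algebra_simps)
  qed
  then show ?thesis
    unfolding hess_def grad_compose_velocity[OF assms(1)]
    by (simp add: vec_eq_iff tensor_def matrix_vector_mult_basis column_def algebra_simps)
qed

section \<open>The oscillating stationary solution\<close>

text \<open>
  The phase \<open>- L\<^sup>3 x\<^sub>1\<close> makes the second summand \<open>L\<^sup>-\<^sup>2 U(L\<^sup>3 x\<^sub>1, L v\<^sub>1)\<close>.
\<close>

definition profile :: "real \<Rightarrow> phase \<Rightarrow> real" where
  "profile L z = 1 + scorer 0 (- (L ^ 3 * fst z $ 1)) (L * velocity (snd z)) / L\<^sup>2"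

definition potential :: "real \<Rightarrow> phase \<Rightarrow> real" where
  "potential L z = cos (L ^ 3 * fst z $ 1) / profile L z"

lemma abs_profile_minus_1: "\<bar>profile L z - 1\<bar> \<le> airy_moment 0 / L\<^sup>2"
  by (simp add: profile_def divide_right_mono abs_scorer_le)

lemma smooth_on_velocity:
  assumes U: "open U"
  shows "smooth_on U (\<lambda>z :: phase. velocity (snd z))"
proof -
  have comp: "smooth_on U (\<lambda>z :: phase. snd z $ i)" for i
    by (rule smooth_on_bounded_linear[OF U])
      (intro bounded_linear_compose[OF bounded_linear_vec_nth bounded_linear_snd])
  have pos: "0 < 1 + p \<bullet> p" for p :: "real ^ 3" using inner_ge_zero[of p] by linarith
  have "velocity p = p $ 1 * (1 + (p $ 1 * p $ 1 + p $ 2 * p $ 2 + p $ 3 * p $ 3)) powr (- (1 / 2))" for p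
    using pos[of p]
    by (simp add: velocity_def bracket_def power2_norm_eq_inner inner_vec_def sum_3 powr_minus
        powr_half_sqrt field_simps)
  then show ?thesis using pos
    by (auto simp: inner_vec_def sum_3
        intro!: smooth_on_mult smooth_on_powr smooth_on_add smooth_on_const comp U)
qed

lemma smooth_on_profile:
  assumes U: "open U"
  shows "smooth_on U (profile L)"
proof -
  have Y: "smooth_on U (\<lambda>z :: phase. L ^ 3 * fst z $ 1)"
    by (rule smooth_on_bounded_linear[OF U])
      (intro bounded_linear_const_mult bounded_linear_compose[OF bounded_linear_vec_nth bounded_linear_fst])
  have scorer: "smooth_on U (\<lambda>z. scorer 0 \<theta> (L * velocity (snd z)))" for \<theta>
  proof -
    have "smooth_on U (\<lambda>z. scorer 0 (\<theta> + real 0 * (pi / 2)) (L * velocity (snd z)))"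
    proof (rule smooth_on_compose_real[OF U, where G = "\<lambda>n. scorer n (\<theta> + real n * (pi / 2))"])
      show "(scorer n (\<theta> + real n * (pi / 2)) has_real_derivative
          scorer (Suc n) (\<theta> + real (Suc n) * (pi / 2)) s) (at s)" for n s
        using DERIV_scorer[of n "\<theta> + real n * (pi / 2)" s] by (simp add: algebra_simps add_divide_distrib)
    qed (intro smooth_on_mult smooth_on_const smooth_on_velocity U)
    then show ?thesis by simp
  qed
  have eq: "profile L = (\<lambda>z. 1 + (cos (L ^ 3 * fst z $ 1 + 0) * scorer 0 0 (L * velocity (snd z))
     + cos (L ^ 3 * fst z $ 1 + pi / 2) * scorer 0 (pi / 2) (L * velocity (snd z))) * (1 / L\<^sup>2))"
    by (rule ext, subst profile_def, subst scorer_phase) (simp add: cos_add)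
  show ?thesis unfolding eq
    by (intro smooth_on_add smooth_on_mult smooth_on_const smooth_on_cos Y scorer U)
qed

lemma continuous_on_profile: "continuous_on UNIV (profile L)"
  using smooth_on_profile[OF open_UNIV, of L] unfolding smooth_on_def by (metis Ck_on.simps(1))

lemma stationary_time_derivative:
  assumes "t \<in> {- (r\<^sup>2)<..0}"
  shows "vector_derivative (\<lambda>s. stationary g (s, x, p)) (at t within {- (r\<^sup>2)<..0}) = 0"
proof (rule vector_derivative_within)
  have "- (r\<^sup>2) < 0" using assms by auto
  then have "t islimpt {- (r\<^sup>2)<..0}" using assms by (simp add: islimpt_Ioc)
  then show "at t within {- (r\<^sup>2)<..0} \<noteq> bot" by (simp add: trivial_limit_within)
qed (simp add: stationary_def)

lemma grad_x_profile:
  assumes "L \<noteq> 0"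
  shows "grad_x (stationary (profile L)) (t, x, p) =
     (- L * scorer 0 (- (L ^ 3 * x $ 1) + pi / 2) (L * velocity p)) *\<^sub>R axis 1 1"
proof -
  let ?\<eta> = "L * velocity p"
  have "((\<lambda>y. 1 + scorer 0 (- (L ^ 3 * y $ 1)) ?\<eta> / L\<^sup>2) has_derivative
     (\<lambda>v. ((- L * scorer 0 (- (L ^ 3 * x $ 1) + pi / 2) ?\<eta>) *\<^sub>R axis 1 1) \<bullet> v)) (at x)"
    using assms
    by (auto intro!: derivative_eq_intros DERIV_compose_FDERIV[OF DERIV_scorer_phase]
        bounded_linear_imp_has_derivative bounded_linear_vec_nth
        simp: fun_eq_iff inner_axis' field_simps eval_nat_numeral)
  then show ?thesis
    by (simp add: grad_x_def stationary_def profile_def grad_eqI)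
qed

lemma DERIV_profile_in_velocity:
  assumes "L \<noteq> 0"
  shows "((\<lambda>s. 1 + scorer 0 \<theta> (L * s) / L\<^sup>2) has_real_derivative scorer 1 (\<theta> + pi / 2) (L * s) / L) (at s)"
    and "((\<lambda>s. scorer 1 (\<theta> + pi / 2) (L * s) / L) has_real_derivative scorer 2 (\<theta> + pi) (L * s)) (at s)"
proof -
  have D: "((\<lambda>s. scorer m \<theta> (L * s)) has_real_derivative scorer (Suc m) (\<theta> + pi / 2) (L * s) * L) (at s)" for m \<theta>
    by (rule DERIV_chain2[OF DERIV_scorer]) (auto intro!: derivative_eq_intros)
  show "((\<lambda>s. 1 + scorer 0 \<theta> (L * s) / L\<^sup>2) has_real_derivative scorer 1 (\<theta> + pi / 2) (L * s) / L) (at s)"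
    using assms by (auto intro!: derivative_eq_intros D simp: power2_eq_square)
  show "((\<lambda>s. scorer 1 (\<theta> + pi / 2) (L * s) / L) has_real_derivative scorer 2 (\<theta> + pi) (L * s)) (at s)"
    using assms DERIV_cdivide[OF D[of 1 "\<theta> + pi / 2"], of L] by (simp add: numeral_2_eq_2 add.commute)
qed

lemma grad_p_profile:
  assumes "L \<noteq> 0"
  shows "grad_p (stationary (profile L)) (t, x, p) =
     (scorer 1 (- (L ^ 3 * x $ 1) + pi / 2) (L * velocity p) / L) *\<^sub>R grad_velocity p"
  using grad_compose_velocity[OF DERIV_profile_in_velocity(1)[OF assms]]
  by (simp add: grad_p_def stationary_def profile_def)

lemma hess_p_profile:
  assumes "L \<noteq> 0"
  shows "hess_p (stationary (profile L)) (t, x, p) =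
     - scorer 2 (- (L ^ 3 * x $ 1)) (L * velocity p) *\<^sub>R tensor (grad_velocity p) (grad_velocity p)
     + (scorer 1 (- (L ^ 3 * x $ 1) + pi / 2) (L * velocity p) / L) *\<^sub>R hess_velocity p"
  using hess_compose_velocity[OF DERIV_profile_in_velocity[OF assms], of "- (L ^ 3 * x $ 1)" p]
    scorer_add_pi[of 2 "- (L ^ 3 * x $ 1)" "L * velocity p"]
  by (simp add: hess_p_def stationary_def profile_def)

text \<open>
  By the two identities for \<open>v\<^sub>1\<close>, the momentum operator applied to the solution is the second
  \<open>\<eta>\<close>-derivative of the Scorer integral, and the transport term is \<open>\<eta>\<close> times its derivative in
  the phase.  Their difference is \<open>cos (L\<^sup>3 x\<^sub>1)\<close>, which the potential was chosen to match.
\<close>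

lemma kinetic_solution_profile:
  assumes "L \<noteq> 0" and nz: "\<And>z. profile L z \<noteq> 0"
  shows "kinetic_solution r (stationary (potential L)) (\<lambda>_. 0) (stationary (profile L))"
  unfolding kinetic_solution_def
proof clarify
  fix t x p assume "(t, x, p) \<in> cylinder r"
  then have t: "t \<in> {- (r\<^sup>2)<..0}" by (simp add: cylinder_def)
  define \<theta> where "\<theta> = - (L ^ 3 * x $ 1)"
  define \<eta> where "\<eta> = L * velocity p"
  have tr: "trace (M ** (a *\<^sub>R S + b *\<^sub>R T)) = a * trace (M ** S) + b * trace (M ** T)"
    for M S T :: "real ^ 3 ^ 3" and a b
    by (simp add: trace_def matrix_matrix_mult_def sum_3 algebra_simps)
  have transport: "(p /\<^sub>R bracket p) \<bullet> grad_x (stationary (profile L)) (t, x, p)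
      = - \<eta> * scorer 0 (\<theta> + pi / 2) \<eta>"
    by (simp add: grad_x_profile[OF assms(1)] inner_axis velocity_def \<theta>_def \<eta>_def field_simps)
  have "trace (A p ** hess_p (stationary (profile L)) (t, x, p))
      + B p \<bullet> grad_p (stationary (profile L)) (t, x, p)
      = - scorer 2 \<theta> \<eta> + scorer 1 (\<theta> + pi / 2) \<eta> / L *
        (trace (A p ** hess_velocity p) + B p \<bullet> grad_velocity p)"
    unfolding hess_p_profile[OF assms(1)] grad_p_profile[OF assms(1)] tr diffusion_of_velocity_is_one
      \<theta>_def \<eta>_def
    by (simp add: distrib_left)
  then have diffusion: "trace (A p ** hess_p (stationary (profile L)) (t, x, p))
      + B p \<bullet> grad_p (stationary (profile L)) (t, x, p) = - scorer 2 \<theta> \<eta>"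
    unfolding velocity_is_driftless by simp
  have reaction: "stationary (potential L) (t, x, p) * stationary (profile L) (t, x, p) = cos \<theta>"
    using nz[of "(x, p)"] by (simp add: stationary_def potential_def \<theta>_def)
  show "vector_derivative (\<lambda>s. stationary (profile L) (s, x, p)) (at t within {- r\<^sup>2<..0})
      + (p /\<^sub>R bracket p) \<bullet> grad_x (stationary (profile L)) (t, x, p)
      = trace (A p ** hess_p (stationary (profile L)) (t, x, p))
        + B p \<bullet> grad_p (stationary (profile L)) (t, x, p)
        + stationary (potential L) (t, x, p) * stationary (profile L) (t, x, p) + 0"
    unfolding stationary_time_derivative[OF t] transport diffusion reaction
    using scorer_equation[of \<theta> \<eta>] by simp
qed

section \<open>Estimates of the potential\<close>

lemma abs_potential_le:
  assumes "\<And>z. 1 / 2 \<le> profile L z"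
  shows "\<bar>potential L z\<bar> \<le> 2"
proof -
  have "\<bar>potential L z\<bar> \<le> 1 / profile L z"
    using assms[of z] by (simp add: potential_def divide_right_mono)
  also have "\<dots> \<le> 2" using assms[of z] by (simp add: field_simps)
  finally show ?thesis .
qed

lemma Linf_norm_potential:
  assumes "\<And>z. 1 / 2 \<le> profile L z"
  shows "Linf_norm Q (stationary (potential L)) \<le> 2"
  unfolding Linf_norm_def
proof (rule esssup_I)
  have "continuous_on UNIV (\<lambda>z :: tphase. potential L (snd z))"
    unfolding potential_def
  proof (intro continuous_on_divide)
    show "continuous_on UNIV (\<lambda>z :: tphase. cos (L ^ 3 * fst (snd z) $ 1))"
      by (intro continuous_intros)
    show "continuous_on UNIV (\<lambda>z :: tphase. profile L (snd z))"
      by (rule continuous_on_compose2[OF continuous_on_profile]) (auto intro: continuous_intros)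
    have "profile L z \<noteq> 0" for z using assms[of z] by linarith
    then show "\<forall>z \<in> UNIV :: tphase set. profile L (snd z) \<noteq> 0" by blast
  qed
  then have "stationary (potential L) \<in> borel_measurable borel"
    by (intro borel_measurable_continuous_onI) (simp add: stationary_def case_prod_beta')
  then have "stationary (potential L) \<in> borel_measurable (lebesgue_on Q)"
    by (intro measurable_restrict_space1 measurable_completion) simp
  then show "(\<lambda>z. ereal \<bar>stationary (potential L) z\<bar>) \<in> borel_measurable (lebesgue_on Q)"
    by measurable
  show "AE z in lebesgue_on Q. ereal \<bar>stationary (potential L) z\<bar> \<le> 2"
    using abs_potential_le[OF assms] by (auto simp: stationary_def)
qed

lemma velocity_lipschitz: "\<bar>velocity p - velocity q\<bar> \<le> 2 * norm (p - q)"
proof -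
  have grad: "norm (grad_velocity r) \<le> 2" for r
  proof -
    have r: "\<bar>r $ 1\<bar> \<le> bracket r" "norm r \<le> bracket r"
    proof -
      show "norm r \<le> bracket r" unfolding bracket_def by (rule real_le_rsqrt) simp
      then show "\<bar>r $ 1\<bar> \<le> bracket r" using component_le_norm_cart[of r 1] by linarith
    qed
    have "norm (grad_velocity r) \<le> 1 / bracket r + \<bar>r $ 1\<bar> / bracket r ^ 3 * norm r"
      unfolding grad_velocity_def using bracket_pos[of r]
      by (intro order_trans[OF norm_triangle_ineq4]) (simp add: norm_axis_1)
    also have "\<bar>r $ 1\<bar> / bracket r ^ 3 * norm r \<le> bracket r / bracket r ^ 3 * bracket r"
      using r bracket_pos[of r] by (intro mult_mono divide_right_mono) auto
    also have "\<dots> = 1 / bracket r" by (simp add: eval_nat_numeral)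
    also have "1 / bracket r \<le> 1" using bracket_ge_1[of r] by simp
    finally show ?thesis by simp
  qed
  have "norm (velocity p - velocity q) \<le> 2 * norm (p - q)"
  proof (rule differentiable_bound[where S = UNIV])
    show "onorm (\<lambda>v. grad_velocity r \<bullet> v) \<le> 2" for r
    proof (rule onorm_le)
      show "norm (grad_velocity r \<bullet> v) \<le> 2 * norm v" for v
        using Cauchy_Schwarz_ineq2[of "grad_velocity r" v] mult_right_mono[OF grad[of r], of "norm v"]
        by simp
    qed
  qed (auto intro: has_derivative_velocity)
  then show ?thesis by simp
qed

lemma scorer_lipschitz: "\<bar>scorer m \<theta> a - scorer m \<theta> b\<bar> \<le> airy_moment (Suc m) * \<bar>a - b\<bar>"
  using field_differentiable_bound[of UNIV "scorer m \<theta>" "\<lambda>\<eta>. scorer (Suc m) (\<theta> + pi / 2) \<eta>"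
      "airy_moment (Suc m)" a b] DERIV_scorer abs_scorer_le
  by simp

text \<open>
  A quantity that is both bounded and Lipschitz in \<open>y\<close> is Hoelder continuous: the Lipschitz
  bound is used for \<open>y \<le> 1\<close> and the uniform one for \<open>y > 1\<close>.
\<close>

lemma le_powr_interpolate:
  fixes a b y :: real
  assumes "0 \<le> a" "0 \<le> b" "0 \<le> y" "0 < \<alpha>" "\<alpha> < 1" "d \<le> a" "d \<le> b * y"
  shows "d \<le> (a + b) * y powr \<alpha>"
proof (cases "y \<le> 1")
  case True
  have "y \<le> y powr \<alpha>"
    using powr_mono'[of \<alpha> 1 y] True assms by simp
  then have "b * y \<le> b * y powr \<alpha>" using assms by (intro mult_left_mono)
  moreover have "0 \<le> a * y powr \<alpha>" using assms by simp
  ultimately show ?thesis using assms(7) unfolding distrib_right by linarith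
next
  case False
  then have "1 \<le> y powr \<alpha>" using assms by (intro ge_one_powr_ge_zero) auto
  then have "a \<le> a * y powr \<alpha>" using mult_left_mono[of 1 "y powr \<alpha>" a] assms by simp
  moreover have "0 \<le> b * y powr \<alpha>" using assms by simp
  ultimately show ?thesis using assms(6) unfolding distrib_right by linarith
qed

text \<open>
  The numerator of the potential does not depend on \<open>p\<close>, and the denominator varies by
  \<open>L\<^sup>-\<^sup>2\<close> times the variation of a bounded Lipschitz function of \<open>L v\<^sub>1\<close>.
\<close>

lemma holder_p_potential:
  assumes "0 < \<alpha>" "\<alpha> < 1" "0 < L" and half: "\<And>z. 1 / 2 \<le> profile L z"
  shows "holder_p \<alpha> Q (stationary (potential L))
     \<le> ereal (8 * (airy_moment 0 + airy_moment 1) * L powr (\<alpha> - 2))"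
  unfolding holder_p_def
proof (rule SUP_least, clarify)
  fix t and x p q :: "real ^ 3" assume pq: "0 < norm (p - q)"
  let ?\<theta> = "- (L ^ 3 * x $ 1)" and ?K = "2 * airy_moment 0 + 2 * airy_moment 1"
  let ?f = "profile L (x, p)" and ?g = "profile L (x, q)"
  define S where "S = \<bar>scorer 0 ?\<theta> (L * velocity p) - scorer 0 ?\<theta> (L * velocity q)\<bar>"
  have "S \<le> ?K * (L * norm (p - q)) powr \<alpha>"
  proof (rule le_powr_interpolate)
    show "S \<le> 2 * airy_moment 0"
      using abs_scorer_le[of 0 ?\<theta> "L * velocity p"] abs_scorer_le[of 0 ?\<theta> "L * velocity q"]
      by (simp add: S_def)
    have "S \<le> airy_moment 1 * (L * \<bar>velocity p - velocity q\<bar>)"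
      using scorer_lipschitz[of 0 ?\<theta> "L * velocity p" "L * velocity q"] \<open>0 < L\<close>
      by (simp add: S_def abs_mult flip: right_diff_distrib)
    also have "\<dots> \<le> airy_moment 1 * (L * (2 * norm (p - q)))"
      using \<open>0 < L\<close> velocity_lipschitz by (intro mult_left_mono airy_moment_nonneg) auto
    finally show "S \<le> 2 * airy_moment 1 * (L * norm (p - q))" by (simp add: mult_ac)
  qed (use assms airy_moment_nonneg in auto)
  then have S: "S / L\<^sup>2 \<le> ?K * L powr (\<alpha> - 2) * norm (p - q) powr \<alpha>"
    using \<open>0 < L\<close> by (simp add: powr_mult powr_diff field_simps)
  have fg: "\<bar>?g - ?f\<bar> = S / L\<^sup>2"
    by (simp add: profile_def S_def abs_minus_commute flip: diff_divide_distrib)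
  have pos: "0 < ?f" "0 < ?g" using half[of "(x, p)"] half[of "(x, q)"] by linarith+
  have "potential L (x, p) - potential L (x, q) = cos (L ^ 3 * x $ 1) * (?g - ?f) / (?f * ?g)"
    using pos by (simp add: potential_def field_simps)
  then have "\<bar>potential L (x, p) - potential L (x, q)\<bar> \<le> \<bar>?g - ?f\<bar> / (?f * ?g)"
    using pos by (simp add: abs_mult divide_right_mono mult_left_le_one_le)
  also have "\<dots> \<le> \<bar>?g - ?f\<bar> / (1 / 4)"
    using mult_mono[of "1 / 2" ?f "1 / 2" ?g] half pos by (intro frac_le) auto
  also have "\<dots> = 4 * (S / L\<^sup>2)"
    by (simp add: fg)
  also have "\<dots> \<le> 4 * (?K * L powr (\<alpha> - 2) * norm (p - q) powr \<alpha>)"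
    using S by (intro mult_left_mono) auto
  finally show "ereal (norm (stationary (potential L) (t, x, p) - stationary (potential L) (t, x, q))
      / norm (p - q) powr \<alpha>) \<le> ereal (8 * (airy_moment 0 + airy_moment 1) * L powr (\<alpha> - 2))"
    using pq by (simp add: stationary_def field_simps)
qed

section \<open>Oscillation of the Hessian\<close>

text \<open>
  At \<open>x = 0\<close> and \<open>p = (\<tau> / L) e\<^sub>1\<close> the scaled velocity \<open>L v\<^sub>1\<close> tends to \<open>\<tau>\<close>, the gradient of \<open>v\<^sub>1\<close>
  tends to \<open>e\<^sub>1\<close>, and the term with \<open>D\<^sup>2v\<^sub>1\<close> carries a factor \<open>1 / L\<close>.
\<close>

lemma tendsto_hess_p_entry:
  "((\<lambda>L. hess_p (stationary (profile L)) (0, 0, (\<tau> / L) *\<^sub>R axis 1 1) $ 1 $ 1) \<longlongrightarrow> scorer 2 pi \<tau>) at_top"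
proof -
  define b where "b = (\<lambda>L. sqrt (1 + (\<tau> / L)\<^sup>2))"
  have s: "((\<lambda>L. \<tau> / L) \<longlongrightarrow> 0) at_top"
    by (intro tendsto_divide_0[OF tendsto_const] filterlim_at_top_imp_at_infinity filterlim_ident)
  have b: "(b \<longlongrightarrow> 1) at_top"
    unfolding b_def by (rule tendsto_eq_intros s | simp)+
  have sc: "((\<lambda>L. scorer m \<theta> (\<tau> / b L)) \<longlongrightarrow> scorer m \<theta> \<tau>) at_top" for m \<theta>
    by (rule isCont_tendsto_compose[OF DERIV_isCont[OF DERIV_scorer]])
      (rule tendsto_eq_intros b | simp)+
  have inv: "((\<lambda>L::real. 1 / L) \<longlongrightarrow> 0) at_top"
    by (intro tendsto_divide_0[OF tendsto_const] filterlim_at_top_imp_at_infinity filterlim_ident)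
  have "((\<lambda>L. scorer 2 pi (\<tau> / b L) * (1 / b L - (\<tau> / L)\<^sup>2 / b L ^ 3)\<^sup>2
      + scorer 1 (pi / 2) (\<tau> / b L) * (1 / L) * (3 * (\<tau> / L) ^ 3 / b L ^ 5 - 3 * (\<tau> / L) / b L ^ 3))
      \<longlongrightarrow> scorer 2 pi \<tau> * (1 / 1 - 0\<^sup>2 / 1 ^ 3)\<^sup>2 + scorer 1 (pi / 2) \<tau> * 0 * (3 * 0 ^ 3 / 1 ^ 5 - 3 * 0 / 1 ^ 3)) at_top"
    by (intro tendsto_intros sc b s inv) auto
  then have "((\<lambda>L. scorer 2 pi (\<tau> / b L) * (1 / b L - (\<tau> / L)\<^sup>2 / b L ^ 3)\<^sup>2
      + scorer 1 (pi / 2) (\<tau> / b L) * (1 / L) * (3 * (\<tau> / L) ^ 3 / b L ^ 5 - 3 * (\<tau> / L) / b L ^ 3))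
      \<longlongrightarrow> scorer 2 pi \<tau>) at_top" by simp
  moreover have "\<forall>\<^sub>F L in at_top. scorer 2 pi (\<tau> / b L) * (1 / b L - (\<tau> / L)\<^sup>2 / b L ^ 3)\<^sup>2
      + scorer 1 (pi / 2) (\<tau> / b L) * (1 / L) * (3 * (\<tau> / L) ^ 3 / b L ^ 5 - 3 * (\<tau> / L) / b L ^ 3)
      = hess_p (stationary (profile L)) (0, 0, (\<tau> / L) *\<^sub>R axis 1 1) $ 1 $ 1"
    using eventually_gt_at_top[of 0]
  proof eventually_elim
    case (elim L)
    define p :: "real ^ 3" where "p = (\<tau> / L) *\<^sub>R axis 1 1"
    have "bracket p = b L" by (simp add: p_def bracket_def b_def norm_axis_1 power_divide)
    moreover have "p $ 1 = \<tau> / L" by (simp add: p_def)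
    ultimately have "L * velocity p = \<tau> / b L"
      and "grad_velocity p $ 1 = 1 / b L - (\<tau> / L)\<^sup>2 / b L ^ 3"
      and "hess_velocity p $ 1 $ 1 = 3 * (\<tau> / L) ^ 3 / b L ^ 5 - 3 * (\<tau> / L) / b L ^ 3"
      using elim
      by (simp_all add: velocity_def grad_velocity_def hess_velocity_def tensor_def mat_def
          power2_eq_square power3_eq_cube) (simp add: field_simps)
    then show ?case
      using elim scorer_add_pi[of 2 0] unfolding p_def[symmetric]
      by (simp add: hess_p_profile tensor_def power2_eq_square)
  qed
  ultimately show ?thesis by (rule Lim_transform_eventually)
qed

text \<open>
  The momenta \<open>0\<close> and \<open>(\<tau> / L) e\<^sub>1\<close> are at distance \<open>\<tau> / L\<close>, while the first diagonal entries
  of the Hessian there are \<open>- 1\<close> and nearly \<open>scorer 2 \<pi> \<tau> \<noteq> - 1\<close>.  The Frobenius norm dominates the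
  difference of the entries.
\<close>

lemma holder_p_hess_lower_bound:
  "\<exists>c>0. \<forall>\<^sub>F L in at_top.
     ereal (c * L powr \<alpha>) \<le> holder_p \<alpha> (cylinder (1 / 2)) (hess_p (stationary (profile L)))"
proof -
  obtain \<tau> where \<tau>: "\<tau> > 0" "scorer 2 pi \<tau> \<noteq> -1" using scorer_second_moment_varies by blast
  define D where "D = \<bar>scorer 2 pi \<tau> + 1\<bar>"
  have D: "0 < D" using \<tau>(2) by (simp add: D_def)
  let ?H = "\<lambda>L p. hess_p (stationary (profile L)) (0, 0, p)" and ?p = "\<lambda>L. (\<tau> / L) *\<^sub>R axis 1 1 :: real ^ 3"
  have "((\<lambda>L. \<bar>?H L (?p L) $ 1 $ 1 + 1\<bar>) \<longlongrightarrow> D) at_top"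
    unfolding D_def by (intro tendsto_intros tendsto_hess_p_entry)
  then have ev: "\<forall>\<^sub>F L in at_top. D / 2 < \<bar>?H L (?p L) $ 1 $ 1 + 1\<bar>"
    using D by (intro order_tendstoD(1)) auto
  have "\<forall>\<^sub>F L in at_top. ereal (D / 2 / \<tau> powr \<alpha> * L powr \<alpha>)
      \<le> holder_p \<alpha> (cylinder (1 / 2)) (hess_p (stationary (profile L)))"
    using ev eventually_gt_at_top[of 0] eventually_gt_at_top[of "2 * \<tau>"]
  proof eventually_elim
    case (elim L)
    have np: "norm (?p L) = \<tau> / L" using \<tau> elim by (simp add: norm_axis_1)
    have small: "\<tau> / L < 1 / 2" using elim by (simp add: field_simps)
    have H0: "?H L 0 $ 1 $ 1 = -1"
      using elim scorer_equation[of 0 0]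
      by (simp add: hess_p_profile tensor_def velocity_def grad_velocity_def hess_velocity_def bracket_def mat_def)
    have "D / 2 \<le> \<bar>(?H L 0 - ?H L (?p L)) $ 1 $ 1\<bar>"
      using elim(1) H0 unfolding vector_minus_component by linarith
    also have "\<dots> \<le> norm (?H L 0 - ?H L (?p L))"
      by (rule order_trans[OF component_le_norm_cart Finite_Cartesian_Product.norm_nth_le])
    finally have "D / 2 / (\<tau> / L) powr \<alpha> \<le> norm (?H L 0 - ?H L (?p L)) / norm (0 - ?p L) powr \<alpha>"
      unfolding diff_0 norm_minus_cancel np by (intro divide_right_mono) simp_all
    moreover have "ereal (norm (?H L 0 - ?H L (?p L)) / norm (0 - ?p L) powr \<alpha>)
        \<le> holder_p \<alpha> (cylinder (1 / 2)) (hess_p (stationary (profile L)))"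
      unfolding holder_p_def
      by (rule SUP_upper2[of "(0, 0, 0, ?p L)"])
        (use np small \<tau> elim in \<open>auto simp: cylinder_def\<close>)
    moreover have "D / 2 / \<tau> powr \<alpha> * L powr \<alpha> = D / 2 / (\<tau> / L) powr \<alpha>"
      using \<tau> elim by (simp add: powr_divide)
    ultimately show ?case
      using order_trans[OF ereal_less_eq(3)[THEN iffD2]] by simp
  qed
  moreover have "0 < D / 2 / \<tau> powr \<alpha>" using D \<tau> by simp
  ultimately show ?thesis by blast
qed

theorem proposition3p5:
  fixes \<alpha> :: real
  assumes "0 < \<alpha>" and "\<alpha> < 1"
  shows "\<exists>c C :: real. c > 0 \<and> C > 0 \<and>
    ((\<lambda>N :: real. C * N powr ((\<alpha> - 2) / 3)) \<longlongrightarrow> 0) at_top \<and>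
    (\<forall>\<^sub>F N :: real in at_top.
      \<exists>(cN :: phase \<Rightarrow> real) (fN :: phase \<Rightarrow> real).
        smooth_on (ball 0 1 \<times> ball 0 1) fN \<and>
        kinetic_solution 1 (stationary cN) (\<lambda>_. 0) (stationary fN) \<and>
        (\<forall>z \<in> cylinder 1. 1 / 2 \<le> stationary fN z \<and> stationary fN z \<le> 3 / 2) \<and>
        Linf_norm (cylinder 1) (stationary cN) \<le> 2 \<and>
        holder_p \<alpha> (cylinder 1) (stationary cN) \<le> ereal (C * N powr ((\<alpha> - 2) / 3)) \<and>
        holder_p \<alpha> (cylinder (1 / 2)) (hess_p (stationary fN)) \<ge> ereal (c * N powr (\<alpha> / 3)))"
proof -
  \<comment> \<open>the summand \<open>1\<close> only makes \<open>C\<close> visibly positive\<close>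
  define C where "C = 8 * (airy_moment 0 + airy_moment 1) + 1"
  have C: "0 < C" using airy_moment_nonneg[of 0] airy_moment_nonneg[of 1] by (simp add: C_def)
  obtain c where c: "c > 0" and low: "\<forall>\<^sub>F L in at_top.
      ereal (c * L powr \<alpha>) \<le> holder_p \<alpha> (cylinder (1 / 2)) (hess_p (stationary (profile L)))"
    using holder_p_hess_lower_bound by blast
  \<comment> \<open>everything is proved for \<open>L\<close> tending to infinity; then \<open>L = N powr (1 / 3)\<close>\<close>
  let ?pair = "\<lambda>u l. \<exists>(cN :: phase \<Rightarrow> real) (fN :: phase \<Rightarrow> real).
        smooth_on (ball 0 1 \<times> ball 0 1) fN \<and>
        kinetic_solution 1 (stationary cN) (\<lambda>_. 0) (stationary fN) \<and>
        (\<forall>z \<in> cylinder 1. 1 / 2 \<le> stationary fN z \<and> stationary fN z \<le> 3 / 2) \<and>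
        Linf_norm (cylinder 1) (stationary cN) \<le> 2 \<and>
        holder_p \<alpha> (cylinder 1) (stationary cN) \<le> ereal (C * u) \<and>
        holder_p \<alpha> (cylinder (1 / 2)) (hess_p (stationary fN)) \<ge> ereal (c * l)"
  have "((\<lambda>L. airy_moment 0 / L\<^sup>2) \<longlongrightarrow> 0) at_top" by real_asymp
  then have "\<forall>\<^sub>F L in at_top. airy_moment 0 / L\<^sup>2 < 1 / 2"
    by (rule order_tendstoD) simp
  then have "\<forall>\<^sub>F L in at_top. ?pair (L powr (\<alpha> - 2)) (L powr \<alpha>)"
    using low eventually_gt_at_top[of 0]
  proof eventually_elim
    case (elim L)
    have half: "1 / 2 \<le> profile L z" "profile L z \<le> 3 / 2" for z
      using abs_profile_minus_1[of L z] elim(1) by linarith+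
    have "holder_p \<alpha> (cylinder 1) (stationary (potential L)) \<le> ereal (C * L powr (\<alpha> - 2))"
      by (rule order_trans[OF holder_p_potential[OF assms elim(3) half(1)]])
        (simp add: C_def mult_right_mono)
    moreover have "profile L z \<noteq> 0" for z using half(1)[of z] by linarith
    then have "kinetic_solution 1 (stationary (potential L)) (\<lambda>_. 0) (stationary (profile L))"
      using elim(3) by (intro kinetic_solution_profile) simp_all
    moreover have "\<forall>z \<in> cylinder 1. 1 / 2 \<le> stationary (profile L) z \<and> stationary (profile L) z \<le> 3 / 2"
      using half by (auto simp: stationary_def)
    moreover have "smooth_on (ball 0 1 \<times> ball 0 1) (profile L)"
      by (intro smooth_on_profile open_Times open_ball)
    ultimately show ?case
      using elim(2) Linf_norm_potential[OF half(1)] by blast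
  qed
  moreover have "filterlim (\<lambda>N :: real. N powr (1 / 3)) at_top at_top" by real_asymp
  ultimately have "\<forall>\<^sub>F N :: real in at_top.
      ?pair ((N powr (1 / 3)) powr (\<alpha> - 2)) ((N powr (1 / 3)) powr \<alpha>)"
    by (rule eventually_compose_filterlim)
  moreover have "(N powr (1 / 3)) powr (\<alpha> - 2) = N powr ((\<alpha> - 2) / 3)"
    "(N powr (1 / 3)) powr \<alpha> = N powr (\<alpha> / 3)" for N :: real
    by (simp_all add: powr_powr)
  ultimately have "\<forall>\<^sub>F N :: real in at_top. ?pair (N powr ((\<alpha> - 2) / 3)) (N powr (\<alpha> / 3))"
    by simp
  moreover have "((\<lambda>N :: real. C * N powr ((\<alpha> - 2) / 3)) \<longlongrightarrow> 0) at_top"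
    using assms by (intro tendsto_mult_right_zero tendsto_neg_powr filterlim_ident) auto
  ultimately show ?thesis using c C by blast
qed

end
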